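(* Let $n\geq3$ and let $$\Lambda(Y)=Y^n+\lambda_{n-1}Y^{n-1}+\lambda_{n-2}Y^{n-2}+\cdots+\lambda_1Y+\lambda_0\in\mathbb{F}_q[X][Y]$$ with $\lambda_0\neq0$. Then $\Lambda$ has exactly $2$ roots in $\overline{\mathbb{F}_q((X^{-1}))}$ of absolute value strictly greater than $1$, all its remaining roots have absolute value $\leq 1$, and at least one of these remaining roots has absolute value exactly $1$, if and only if $$|\lambda_{n-1}|<|\lambda_{n-2}|=\max_{0\leq i<n-2}|\lambda_i|.$$
   Context: $\mathbb{F}_q$ is a finite field, $\mathbb{F}_q((X^{-1}))$ the field of formal Laurent series $\sum_{i\geq n_0}\omega_iX^{-i}$ over $\mathbb{F}_q$, with absolute value $|\omega|=q^{\deg\omega}$ where $\deg\omega$ is the largest exponent of $X$ with nonzero coefficient ($|0|=0$); in particular for a polynomial $\lambda\in\mathbb{F}_q[X]$, $|\lambda|=q^{\deg\lambda}$. The absolute value extends uniquely to an algebraic closure $\overline{\mathbb{F}_q((X^{-1}))}$.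
   Formalization: Roots are counted with multiplicity, and it is additionally assumed that some λ_i (i<n) is non-constant: for Λ in F_q[Y] the claim can fail, e.g. Y^3+Y+1 over F_2 satisfies the coefficient condition but all its roots have absolute value 1. *)

theory Defs
  imports "HOL-Algebra.Algebraic_Closure_Type" "HOL-Library.Cardinality" Complex_Main
begin

(* The field of formal Laurent series in 1/X is the library type 'a fls whose formal
   variable fls_X plays the role of 1/X; hence X itself is fls_X_inv, and the degree of a
   nonzero series in X is the negative of its fls_subdegree. *)

definition laurent_of_poly :: "'a::field poly \<Rightarrow> 'a fls" where
  "laurent_of_poly p = poly (map_poly fls_const p) fls_X_inv"

definition laurent_abs :: "'a::{field,finite} fls \<Rightarrow> real" where
  "laurent_abs w = (if w = 0 then 0 else real CARD('a) powi (- fls_subdegree w))"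

definition poly_abs :: "'a::{field,finite} poly \<Rightarrow> real" where
  "poly_abs p = laurent_abs (laurent_of_poly p)"

definition absolute_value :: "('k::field \<Rightarrow> real) \<Rightarrow> bool" where
  "absolute_value v \<longleftrightarrow>
     (\<forall>x. 0 \<le> v x) \<and>
     (\<forall>x. v x = 0 \<longleftrightarrow> x = 0) \<and>
     (\<forall>x y. v (x * y) = v x * v y) \<and>
     (\<forall>x y. v (x + y) \<le> v x + v y)"

(* The extension of laurent_abs to the algebraic closure exists and is unique (classical), so
   a statement about that extension is rendered as one about every v with this property. *)
definition extends_laurent_abs :: "('a::{field,finite} fls alg_closure \<Rightarrow> real) \<Rightarrow> bool" where
  "extends_laurent_abs v \<longleftrightarrow> absolute_value v \<and> (\<forall>w. v (to_ac w) = laurent_abs w)"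

(* Multiset of roots in the algebraic closure: roots are counted with multiplicity. *)
definition closure_roots :: "'a::{field,finite} poly poly \<Rightarrow> 'a fls alg_closure multiset" where
  "closure_roots \<Lambda> = proots (map_poly (\<lambda>c. to_ac (laurent_of_poly c)) \<Lambda>)"

(* Pitfall: if every coefficient of \<Lambda> is a constant, all roots are algebraic over the finite
   field, hence of absolute value at most 1, so \<Lambda> does not have two large roots; yet the
   coefficients may satisfy |l_(n-1)| = 0 < |l_(n-2)| = 1 = max |l_i|, as for Y^3 + Y + 1.
   A criterion for two_large_roots in these terms must exclude that case. *)
definition two_large_roots ::
    "('a::{field,finite} fls alg_closure \<Rightarrow> real) \<Rightarrow> 'a poly poly \<Rightarrow> bool" where
  "two_large_roots v \<Lambda> \<longleftrightarrow>
     (let R = closure_roots \<Lambda>; big = {#w \<in># R. 1 < v w#}; rest = R - big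
      in size big = 2 \<and> (\<forall>w \<in># rest. v w \<le> 1) \<and> (\<exists>w \<in># rest. v w = 1))"

lemma laurent_of_poly_nth:
  "fls_nth (laurent_of_poly p) k = (if k \<le> 0 then Polynomial.coeff p (nat (- k)) else 0)"
proof -
  have "laurent_of_poly p =
      (\<Sum>i\<le>Polynomial.degree p. fls_const (Polynomial.coeff p i) * fls_X_inv ^ i)"
    unfolding laurent_of_poly_def
    by (simp add: poly_altdef coeff_map_poly degree_map_poly fls_const_nonzero)
  hence "fls_nth (laurent_of_poly p) k =
      (\<Sum>i\<le>Polynomial.degree p. Polynomial.coeff p i * (if k = - int i then 1 else 0))"
    by (simp add: fls_nth_sum)
  also have "\<dots> = (\<Sum>i\<le>Polynomial.degree p.
      if i = nat (- k) then (if k \<le> 0 then Polynomial.coeff p i else 0) else 0)"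
    by (intro sum.cong) auto
  also have "\<dots> = (if k \<le> 0 then Polynomial.coeff p (nat (- k)) else 0)"
    by (auto simp: coeff_eq_0)
  finally show ?thesis .
qed

lemma poly_abs_eq:
  fixes p :: "'a::{field,finite} poly"
  shows "poly_abs p = (if p = 0 then 0 else real CARD('a) ^ Polynomial.degree p)"
proof (cases "p = 0")
  case True
  thus ?thesis by (simp add: poly_abs_def laurent_abs_def laurent_of_poly_def)
next
  case False
  have nz: "fls_nth (laurent_of_poly p) (- int (Polynomial.degree p)) \<noteq> 0"
    using False by (simp add: laurent_of_poly_nth)
  have "fls_subdegree (laurent_of_poly p) = - int (Polynomial.degree p)"
    by (rule fls_subdegree_eqI[OF nz]) (auto simp: laurent_of_poly_nth coeff_eq_0)
  moreover from nz have "laurent_of_poly p \<noteq> 0" by auto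
  ultimately show ?thesis
    using False by (simp add: poly_abs_def laurent_abs_def)
qed

end

theory Submission
  imports Defs
begin

text \<open>For a polynomial over a field with an ultrametric absolute value, look at the
coefficients that attain the Gauss norm \<open>M\<close>, the largest absolute value of a coefficient. If the
polynomial splits, the smallest index \<open>l\<close> of such a coefficient is the number of roots in the open
unit disc, and the largest such index \<open>h\<close> is the number of roots in the closed unit disc; both are
seen by multiplying in one linear factor at a time. Two roots outside the closed disc and one
on the unit circle therefore mean that the largest index is \<open>n - 2\<close> and the smallest one is less
than \<open>n - 2\<close>.\<close>

lemma coeff_linear_factor_mult:
  fixes p :: "'b::comm_ring_1 poly"
  shows "Polynomial.coeff ([:- w, 1:] * p) i =
     (if i = 0 then 0 else Polynomial.coeff p (i - 1)) - w * Polynomial.coeff p i"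
  by (simp add: mult_pCons_left coeff_pCons')

section \<open>Absolute values on a field and the ultrametric inequality\<close>

locale abs_val =
  fixes v :: "'k::field \<Rightarrow> real"
  assumes absolute_value: "absolute_value v"
begin

lemma nonneg [simp]: "0 \<le> v x"
  and eq_0_iff [simp]: "v x = 0 \<longleftrightarrow> x = 0"
  and mult: "v (x * y) = v x * v y"
  and triangle: "v (x + y) \<le> v x + v y"
  using absolute_value unfolding absolute_value_def by blast+

lemma zero [simp]: "v 0 = 0"
  by (simp only: eq_0_iff)

lemma one [simp]: "v 1 = 1"
  using mult[of 1 1] by simp

lemma minus [simp]: "v (- x) = v x"
proof -
  have "v (-1) * v (-1) = 1"
    using mult[of "-1" "-1"] by simp
  hence "v (-1) = 1"
    using nonneg[of "-1"] by (metis abs_of_nonneg power2_eq_square real_sqrt_abs real_sqrt_one)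
  thus ?thesis
    using mult[of "-1" x] by simp
qed

lemma power: "v (x ^ m) = v x ^ m"
  by (induction m) (simp_all add: mult)

lemma sum_le: "v (\<Sum>i\<in>A. f i) \<le> (\<Sum>i\<in>A. v (f i))"
proof (induction A rule: infinite_finite_induct)
  case (insert a A)
  thus ?case
    using triangle[of "f a" "sum f A"] by simp
qed simp_all

text \<open>The binomial theorem bounds the \<open>m\<close>-th power of \<open>v (x + y)\<close> by \<open>m + 1\<close> times that of the
maximum; the linear factor is harmless as \<open>m\<close> grows.\<close>

lemma ultrametricI:
  assumes "\<And>m. v (of_nat m) \<le> 1"
  shows "v (x + y) \<le> max (v x) (v y)"
proof (rule ccontr)
  define M where "M = max (v x) (v y)"
  assume "\<not> v (x + y) \<le> max (v x) (v y)"
  hence less: "M < v (x + y)"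
    by (simp only: M_def not_le)
  have "0 \<le> M"
    by (simp add: M_def le_max_iff_disj)
  have bound: "v (x + y) ^ m \<le> real (Suc m) * M ^ m" for m
  proof -
    have "v (x + y) ^ m = v (\<Sum>k\<le>m. of_nat (m choose k) * x ^ k * y ^ (m - k))"
      by (simp flip: power binomial_ring)
    also have "\<dots> \<le> (\<Sum>k\<le>m. v (of_nat (m choose k) * x ^ k * y ^ (m - k)))"
      by (rule sum_le)
    also have "\<dots> \<le> (\<Sum>k\<le>m. M ^ m)"
    proof (rule sum_mono)
      fix k assume "k \<in> {..m}"
      have "v (of_nat (m choose k) * x ^ k * y ^ (m - k)) \<le> 1 * M ^ k * M ^ (m - k)"
        unfolding mult power
        by (intro mult_mono power_mono assms mult_nonneg_nonneg)
          (simp_all add: M_def le_max_iff_disj)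
      also have "\<dots> = M ^ m"
        using \<open>k \<in> {..m}\<close> by (simp flip: power_add)
      finally show "v (of_nat (m choose k) * x ^ k * y ^ (m - k)) \<le> M ^ m" .
    qed
    also have "\<dots> = real (Suc m) * M ^ m"
      by simp
    finally show ?thesis .
  qed
  have pos: "0 < v (x + y)"
    using less \<open>0 \<le> M\<close> by linarith
  \<comment> \<open>The bound, divided by \<open>v (x + y) ^ m\<close>, reads
    \<open>1 \<le> (m + 1) * q ^ m\<close>; since \<open>q < 1\<close>, the right-hand side tends to
    0.\<close>
  define q where "q = M / v (x + y)"
  have "norm q < 1"
    using less pos \<open>0 \<le> M\<close> by (simp add: q_def)
  hence "(\<lambda>m. of_nat m * q ^ m + q ^ m) \<longlonglongrightarrow> 0 + 0"
    by (intro tendsto_add powser_times_n_limit_0 LIMSEQ_power_zero)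
  moreover have "1 \<le> of_nat m * q ^ m + q ^ m" for m
  proof -
    have "of_nat m * q ^ m + q ^ m = real (Suc m) * M ^ m / v (x + y) ^ m"
      by (simp add: q_def power_divide distrib_right add_divide_distrib)
    thus ?thesis
      using bound[of m] pos by (simp add: le_divide_eq)
  qed
  ultimately have "(1::real) \<le> 0 + 0"
    by (intro LIMSEQ_le_const) auto
  thus False
    by simp
qed

end

section \<open>Gauss norm of a product of linear factors\<close>

locale ultrametric_abs_val = abs_val +
  assumes ultrametric: "v (x + y) \<le> max (v x) (v y)"
begin

lemma diff_le: "v x \<le> c \<Longrightarrow> v y \<le> c \<Longrightarrow> v (x - y) \<le> c"
  and diff_less: "v x < c \<Longrightarrow> v y < c \<Longrightarrow> v (x - y) < c"
  using ultrametric[of x "- y"] by (auto simp: max_def split: if_splits)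

text \<open>Write \<open>x\<close> as \<open>(x - y) + y\<close>: as \<open>v y < v x\<close>, the
  maximum in the ultrametric inequality can only be \<open>v (x - y)\<close>, which gives the
  missing lower bound.\<close>

lemma diff_eq_left: "v y < v x \<Longrightarrow> v (x - y) = v x"
  using diff_le[of x "v x" y] ultrametric[of "x - y" y] by (auto simp: max_def split: if_splits)

lemma diff_eq_right: "v x < v y \<Longrightarrow> v (x - y) = v y"
  using diff_eq_left[of x y] minus[of "x - y"] by simp

text \<open>In terms of the Newton polygon, \<open>l\<close> and \<open>h\<close> are the ends of
  the side of slope zero, which shrinks to a vertex when \<open>l = h\<close>.\<close>

definition gauss_norm_extremes :: "'a poly \<Rightarrow> real \<Rightarrow> nat \<Rightarrow> nat \<Rightarrow> bool" where
  "gauss_norm_extremes p M l h \<longleftrightarrow> 0 < M \<and> (\<forall>i. v (Polynomial.coeff p i) \<le> M) \<and>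
     v (Polynomial.coeff p l) = M \<and> v (Polynomial.coeff p h) = M \<and>
     (\<forall>i<l. v (Polynomial.coeff p i) < M) \<and> (\<forall>i>h. v (Polynomial.coeff p i) < M)"

text \<open>The product is a shifted copy \<open>a\<close> of the coefficients minus a scaled copy
  \<open>b\<close>. For \<open>v w < 1\<close> the shifted copy dominates and both ends move up by
  one; for \<open>1 < v w\<close> the scaled copy dominates and both stay.\<close>

lemma gauss_norm_extremes_linear_factor_mult:
  assumes "gauss_norm_extremes p M l h"
  shows "gauss_norm_extremes ([:- w, 1:] * p) (M * max 1 (v w))
           (l + (if v w < 1 then 1 else 0)) (h + (if v w \<le> 1 then 1 else 0))"
proof -
  define a where "a i = (if i = 0 then 0 else Polynomial.coeff p (i - 1))" for i
  define b where "b i = w * Polynomial.coeff p i" for i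
  have M: "0 < M"
    and le: "\<And>i. v (Polynomial.coeff p i) \<le> M"
    and l: "v (Polynomial.coeff p l) = M" "\<And>i. i < l \<Longrightarrow> v (Polynomial.coeff p i) < M"
    and h: "v (Polynomial.coeff p h) = M" "\<And>i. h < i \<Longrightarrow> v (Polynomial.coeff p i) < M"
    using assms by (auto simp: gauss_norm_extremes_def)
  have c: "Polynomial.coeff ([:- w, 1:] * p) i = a i - b i" for i
    unfolding a_def b_def by (rule coeff_linear_factor_mult)
  have a: "v (a i) \<le> M" "i \<le> l \<Longrightarrow> v (a i) < M" "h + 1 < i \<Longrightarrow> v (a i) < M"
    "v (a (l + 1)) = M" "v (a (h + 1)) = M" for i
    using M le l h by (auto simp: a_def)
  have b: "v (b i) = v w * v (Polynomial.coeff p i)" for i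
    by (simp add: b_def mult)
  have b_le: "v (b i) \<le> v w * M" for i
    unfolding b using le by (intro mult_left_mono) auto
  consider "v w < 1" | "v w = 1" | "1 < v w" by linarith
  thus ?thesis
  proof cases
    case 1
    have b1: "v (b i) < M" for i
      using b_le[of i] mult_strict_right_mono[OF 1 M] by simp
    have "v (a i - b i) \<le> M" for i
      using a(1) less_imp_le[OF b1] by (rule diff_le)
    moreover have "v (a (l + 1) - b (l + 1)) = M" "v (a (h + 1) - b (h + 1)) = M"
      using a(4,5) b1 diff_eq_left by metis+
    moreover have "v (a i - b i) < M" if "i < l + 1 \<or> h + 1 < i" for i
    proof (rule diff_less[OF _ b1])
      show "v (a i) < M"
        using a(2,3)[of i] that by linarith
    qed
    ultimately show ?thesis
      unfolding gauss_norm_extremes_def c using 1 M by (simp add: max_def)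
  next
    case 2
    have b1: "v (b i) = v (Polynomial.coeff p i)" for i
      using b 2 by simp
    have "v (a i - b i) \<le> M" for i
      using a(1) b1 le by (intro diff_le) simp_all
    \<comment> \<open>Only for \<open>v w = 1\<close> can two terms of size \<open>M\<close> cancel.
      The ends survive: at \<open>l\<close> only \<open>b\<close> attains \<open>M\<close>, and at
      \<open>h + 1\<close> only \<open>a\<close> does.\<close>
    moreover have "v (a l - b l) = M"
      using a(2)[of l] b1[of l] l(1) diff_eq_right[of "a l" "b l"] by simp
    moreover have "v (a (h + 1) - b (h + 1)) = M"
      using a(5) b1[of "h + 1"] h(2)[of "h + 1"] diff_eq_left[of "b (h + 1)" "a (h + 1)"] by simp
    moreover have "v (a i - b i) < M" if "i < l \<or> h + 1 < i" for i
      using that a(2,3)[of i] b1[of i] l(2)[of i] h(2)[of i] by (intro diff_less) auto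
    ultimately show ?thesis
      unfolding gauss_norm_extremes_def c using 2 M by simp
  next
    case 3
    have a1: "v (a i) < v w * M" for i
      using a(1)[of i] mult_strict_right_mono[OF 3 M] by simp
    have b1: "v (b i) < v w * M" if "i < l \<or> h < i" for i
      unfolding b using that l h 3 by (intro mult_strict_left_mono) auto
    have b2: "v (b l) = v w * M" "v (b h) = v w * M"
      using b l h by auto
    have "0 < v w * M"
      using 3 M by simp
    moreover have "v (a i - b i) \<le> v w * M" for i
      using less_imp_le[OF a1] b_le by (rule diff_le)
    moreover have "v (a l - b l) = v w * M" "v (a h - b h) = v w * M"
      using a1 b2 diff_eq_right by metis+
    moreover have "v (a i - b i) < v w * M" if "i < l \<or> h < i" for i
      using a1 b1[OF that] by (rule diff_less)
    moreover have "M * max 1 (v w) = v w * M"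
      using 3 by simp
    ultimately show ?thesis
      unfolding gauss_norm_extremes_def c using 3 by (simp add: mult.commute)
  qed
qed

text \<open>Start from the constant 1, where both indices are 0; each further root raises an index
  exactly when it enters the corresponding count.\<close>

lemma gauss_norm_extremes_prod_mset_linear_factors:
  "\<exists>M. gauss_norm_extremes (\<Prod>x\<in>#A. [:- x, 1:]) M
         (size {#x \<in># A. v x < 1#}) (size {#x \<in># A. v x \<le> 1#})"
proof (induction A)
  case empty
  have "gauss_norm_extremes 1 1 0 0"
    by (auto simp: gauss_norm_extremes_def coeff_1)
  thus ?case
    by auto
next
  case (add w A)
  then obtain M where "gauss_norm_extremes (\<Prod>x\<in>#A. [:- x, 1:]) M
      (size {#x \<in># A. v x < 1#}) (size {#x \<in># A. v x \<le> 1#})"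
    by blast
  from gauss_norm_extremes_linear_factor_mult[OF this, of w] show ?case
    by (auto split: if_splits)
qed

end

section \<open>Roots over the closure of the Laurent series field\<close>

lemma ultrametric_of_extends_laurent_abs:
  fixes v :: "'a::{field,finite} fls alg_closure \<Rightarrow> real"
  assumes "extends_laurent_abs v"
  shows "ultrametric_abs_val v"
proof -
  interpret abs_val v
    using assms by unfold_locales (simp add: extends_laurent_abs_def)
  \<comment> \<open>Natural numbers are constant series, of subdegree 0, so their absolute value is
    0 or 1.\<close>
  have "v (of_nat m) \<le> 1" for m
  proof -
    have "v (to_ac (of_nat m)) = laurent_abs (of_nat m :: 'a fls)"
      using assms unfolding extends_laurent_abs_def by blast
    thus ?thesis
      by (simp add: laurent_abs_def)
  qed
  thus ?thesis
    by unfold_locales (rule ultrametricI)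
qed

lemma laurent_of_poly_0 [simp]: "laurent_of_poly 0 = 0"
  and laurent_of_poly_1 [simp]: "laurent_of_poly 1 = 1"
  by (simp_all add: laurent_of_poly_def)

text \<open>Algebraic closedness gives a factorization over some multiset \<open>A\<close>; it is
  \<open>proots p\<close> because \<open>proots\<close> turns products of nonzero polynomials into
  sums.\<close>

lemma closed_field_proots:
  fixes p :: "'k::alg_closed_field poly"
  assumes "Polynomial.lead_coeff p = 1"
  shows "p = (\<Prod>x\<in>#proots p. [:- x, 1:])" "size (proots p) = Polynomial.degree p"
proof -
  have "p \<noteq> 0"
    using assms by auto
  then obtain A where A: "size A = Polynomial.degree p" "p = (\<Prod>x\<in>#A. [:- x, 1:])"
    using alg_closed_imp_factorization[of p] assms by auto
  have "proots p = A"
    unfolding A(2)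
  proof (induction A)
    case (add x A)
    have "(\<Prod>y\<in>#A. [:- y, 1:]) \<noteq> 0"
      by (auto simp: prod_mset_zero_iff)
    with add show ?case
      by (simp add: proots_mult del: mult_pCons_left)
  qed simp
  with A show "p = (\<Prod>x\<in>#proots p. [:- x, 1:])" "size (proots p) = Polynomial.degree p"
    by simp_all
qed

lemma Max_image_eq_iff:
  fixes f :: "'b \<Rightarrow> 'c::linorder"
  assumes "finite A" "A \<noteq> {}"
  shows "c = Max (f ` A) \<longleftrightarrow> (\<forall>i\<in>A. f i \<le> c) \<and> (\<exists>i\<in>A. f i = c)"
  using assms by (subst eq_Max_iff) auto

text \<open>The roots outside the closed disc are the complement of those inside, and the number on
  the unit circle is the difference of the closed and open disc counts. These two counts are the
  indices given by the Gauss norm.\<close>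

lemma two_large_roots_iff_size:
  assumes "size (closure_roots \<Lambda>) = n" "n \<ge> 2"
  shows "two_large_roots v \<Lambda> \<longleftrightarrow>
    size {#w \<in># closure_roots \<Lambda>. v w \<le> 1#} = n - 2 \<and>
    size {#w \<in># closure_roots \<Lambda>. v w < 1#} < n - 2"
proof -
  define R where "R = closure_roots \<Lambda>"
  have rest: "R - {#w \<in># R. 1 < v w#} = {#w \<in># R. v w \<le> 1#}"
    by (rule multiset_eqI) auto
  have "R = {#w \<in># R. 1 < v w#} + {#w \<in># R. v w \<le> 1#}"
    by (rule multiset_eqI) auto
  hence *: "n = size {#w \<in># R. 1 < v w#} + size {#w \<in># R. v w \<le> 1#}"
    using assms(1) by (metis R_def size_union)
  have "{#w \<in># R. v w \<le> 1#} = {#w \<in># R. v w < 1#} + {#w \<in># R. v w = 1#}"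
    by (rule multiset_eqI) auto
  hence "size {#w \<in># R. v w \<le> 1#} = size {#w \<in># R. v w < 1#} + size {#w \<in># R. v w = 1#}"
    by simp
  moreover have "(\<exists>w\<in>#{#w \<in># R. v w \<le> 1#}. v w = 1) \<longleftrightarrow> {#w \<in># R. v w = 1#} \<noteq> {#}"
    by (auto simp: multiset_eq_iff not_in_iff)
  hence "(\<exists>w\<in>#{#w \<in># R. v w \<le> 1#}. v w = 1) \<longleftrightarrow> 0 < size {#w \<in># R. v w = 1#}"
    by (simp only: nonempty_has_size)
  moreover have "\<forall>w\<in>#{#w \<in># R. v w \<le> 1#}. v w \<le> 1"
    by simp
  ultimately show ?thesis
    using * assms(2) unfolding two_large_roots_def Let_def R_def[symmetric] rest by linarith
qed

theorem theorem4p4: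
  fixes n :: nat
    and \<Lambda> :: "'a::{field,finite} poly poly"
    and v :: "'a fls alg_closure \<Rightarrow> real"
  assumes "extends_laurent_abs v"
    and "n \<ge> 3"
    and "Polynomial.degree \<Lambda> = n"
    and "Polynomial.lead_coeff \<Lambda> = 1"
    and "Polynomial.coeff \<Lambda> 0 \<noteq> 0"
    and "\<exists>i<n. Polynomial.degree (Polynomial.coeff \<Lambda> i) > 0"
  shows "two_large_roots v \<Lambda> \<longleftrightarrow>
     poly_abs (Polynomial.coeff \<Lambda> (n - 1)) < poly_abs (Polynomial.coeff \<Lambda> (n - 2)) \<and>
     poly_abs (Polynomial.coeff \<Lambda> (n - 2)) =
       Max ((\<lambda>i. poly_abs (Polynomial.coeff \<Lambda> i)) ` {0..<n - 2})"
proof -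
  interpret ultrametric_abs_val v
    using assms(1) by (rule ultrametric_of_extends_laurent_abs)
  define p where "p = map_poly (\<lambda>c. to_ac (laurent_of_poly c)) \<Lambda>"
  define a where "a i = poly_abs (Polynomial.coeff \<Lambda> i)" for i
  have a: "v (Polynomial.coeff p i) = a i" for i
    using assms(1) by (simp add: p_def a_def coeff_map_poly poly_abs_def extends_laurent_abs_def)
  have "Polynomial.coeff p n = 1"
    using assms(3,4) by (simp add: p_def coeff_map_poly)
  hence deg: "Polynomial.degree p = n"
    using assms(3)
    by (intro antisym le_degree degree_le) (auto simp: p_def coeff_map_poly coeff_eq_0)
  have lc: "Polynomial.lead_coeff p = 1"
    using deg \<open>Polynomial.coeff p n = 1\<close> by simp
  have R: "closure_roots \<Lambda> = proots p"
    by (simp add: closure_roots_def p_def)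
  define l where "l = size {#w \<in># proots p. v w < 1#}"
  define h where "h = size {#w \<in># proots p. v w \<le> 1#}"
  have "\<exists>M. gauss_norm_extremes (\<Prod>x\<in>#proots p. [:- x, 1:]) M l h"
    unfolding l_def h_def by (rule gauss_norm_extremes_prod_mset_linear_factors)
  then obtain M where "gauss_norm_extremes p M l h"
    by (simp only: closed_field_proots(1)[OF lc, symmetric]) blast
  hence M: "\<And>i. a i \<le> M" "a l = M" "a h = M" "\<And>i. i < l \<Longrightarrow> a i < M" "\<And>i. h < i \<Longrightarrow> a i < M"
    unfolding gauss_norm_extremes_def a by auto
  have an: "a n = 1" "\<And>i. n < i \<Longrightarrow> a i = 0"
    using assms(3,4) by (auto simp: a_def poly_abs_eq coeff_eq_0)
  \<comment> \<open>A nonconstant coefficient has absolute value at least \<open>CARD('a)\<close>,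
    so it exceeds the leading coefficient, whose absolute value is 1.\<close>
  obtain i where i: "i < n" "1 < a i"
  proof -
    obtain i where i: "i < n" "Polynomial.degree (Polynomial.coeff \<Lambda> i) > 0"
      using assms(6) by blast
    moreover have "1 < CARD('a)"
      using card_mono[of UNIV "{0, 1 :: 'a}"] by simp
    ultimately have "1 < a i"
      by (auto simp: a_def poly_abs_eq)
    with i(1) show ?thesis by (rule that)
  qed
  have "two_large_roots v \<Lambda> \<longleftrightarrow> h = n - 2 \<and> l < n - 2"
    using two_large_roots_iff_size[of \<Lambda> n v] closed_field_proots(2)[OF lc] assms(2) deg
    unfolding R l_def h_def by simp
  also have "\<dots> \<longleftrightarrow> a (n - 1) < a (n - 2) \<and>
      ((\<forall>j\<in>{0..<n - 2}. a j \<le> a (n - 2)) \<and> (\<exists>j\<in>{0..<n - 2}. a j = a (n - 2)))"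
    (is "?L \<longleftrightarrow> ?C")
  proof
    assume ?L
    \<comment> \<open>Here \<open>M = a (n - 2)\<close>; the index \<open>n - 1\<close> lies above
      \<open>h\<close>, and \<open>l\<close> is the index below \<open>n - 2\<close> that attains
      the maximum.\<close>
    thus ?C
      using M assms(2) by auto
  next
    assume C: ?C
    then obtain j where j: "j < n - 2" "a j = a (n - 2)"
      by auto
    have small: "k < n - 2 \<or> k = n - 2 \<or> k = n - 1 \<or> n \<le> k" for k
      by linarith
    \<comment> \<open>\<open>?C\<close> compares only the coefficients below index \<open>n\<close>;
      the large coefficient \<open>a i\<close> is what puts \<open>a (n - 2)\<close> above the
      leading one as well.\<close>
    have "a i \<le> a (n - 2)"
      using i(1) C small[of i] by auto
    with i(2) have "1 < a (n - 2)"
      by linarith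
    hence gt: "a k < a (n - 2)" if "n - 2 < k" for k
      using that C an small[of k] by (cases "k = n") auto
    moreover have "a k \<le> a (n - 2)" for k
      using C gt[of k] small[of k] by (cases "n - 2 < k") auto
    ultimately have M_eq: "M = a (n - 2)"
      using M(1)[of "n - 2"] M(2) by (metis antisym)
    \<comment> \<open>If \<open>h\<close> were smaller, \<open>a (n - 2)\<close> would be less than
      \<open>M\<close>; if it were larger, \<open>a h\<close> would be. Likewise \<open>j\<close>
      attains \<open>M\<close>, so it cannot lie below \<open>l\<close>.\<close>
    have "h = n - 2"
      using M(3) M(5)[of "n - 2"] gt[of h] M_eq by (cases h "n - 2" rule: linorder_cases) auto
    moreover have "l \<le> j"
      using M(4)[of j] j M_eq by (cases "j < l") auto
    ultimately show ?L
      using j(1) by simp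
  qed
  also have "\<dots> \<longleftrightarrow> a (n - 1) < a (n - 2) \<and> a (n - 2) = Max (a ` {0..<n - 2})"
    using assms(2) by (subst Max_image_eq_iff) auto
  finally show ?thesis
    unfolding a_def .
qed

end
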